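(* Let $m$ be a positive integer with $m\not\equiv 2\pmod 3$. Then the function $f:\mathbb{F}_{2^{3m}}\to\mathbb{F}_{2^{3m}}$, $$f(x)=x^{2^m+1}+x^{2^{2m}+2^m},$$ is pseudo-planar on $\mathbb{F}_{2^{3m}}$.
   Context: A function $f:\mathbb{F}_{2^n}\to\mathbb{F}_{2^n}$ is called pseudo-planar if for every $\epsilon\in\mathbb{F}_{2^n}^*$ the map $x\mapsto f(x+\epsilon)+f(x)+\epsilon x$ is a permutation of $\mathbb{F}_{2^n}$. *)

theory Defs
  imports "HOL-Library.Cardinality" "HOL-Number_Theory.Cong"
begin

text \<open>
  The field with \<open>2 ^ n\<close> elements is rendered as an arbitrary finite field type \<open>'a\<close> with
  \<open>CARD('a) = 2 ^ n\<close>; that condition is imposed where the definition is used. Pseudo-planarity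
  is only meant for such fields, which have characteristic 2.
\<close>

definition pseudo_planar :: "('a::{field,finite} \<Rightarrow> 'a) \<Rightarrow> bool" where
  "pseudo_planar f \<longleftrightarrow> (\<forall>\<epsilon>. \<epsilon> \<noteq> 0 \<longrightarrow> bij (\<lambda>x. f (x + \<epsilon>) + f x + \<epsilon> * x))"

end

theory Submission
  imports Defs "HOL-Computational_Algebra.Polynomial"
begin

text \<open>
  Let \<open>q = 2 ^ m\<close> and \<open>\<sigma> x = x ^ q\<close>, an automorphism of order 3. Up to a constant, the difference
  map of \<open>f\<close> at \<open>a\<close> is the additive map
  \<open>x \<mapsto> (a + b) * x + (a + c) * \<sigma> x + b * \<sigma> (\<sigma> x)\<close> where \<open>b = \<sigma> a\<close> and \<open>c = \<sigma> b\<close>. Applying \<open>\<sigma>\<close> to the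
  equation of its kernel gives a \<open>3 \<times> 3\<close> linear system in \<open>x, \<sigma> x, \<sigma> (\<sigma> x)\<close>, whose determinant
  is a cubic form in \<open>a, b, c\<close>. Over the subfield with 8 elements, with \<open>w ^ 3 = w + 1\<close>, this form
  splits into the linear factors \<open>a + r * b + r ^ 5 * c\<close> for \<open>r = w, w\<^sup>2, w\<^sup>4\<close>. If one of them
  vanishes, then so do its images under \<open>\<sigma>\<close>; since \<open>\<sigma> r\<close> is \<open>r\<close> or \<open>r\<^sup>2\<close> when \<open>m\<close> is not
  congruent to 2 modulo 3, this is again a regular linear system, and \<open>a = 0\<close>.
\<close>

text \<open>Multiplication by \<open>x\<close> permutes the nonzero elements, so it leaves their
  product unchanged.\<close>

lemma finite_field_power_card_minus_one:
  fixes x :: "'a::{field,finite}"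
  assumes "x \<noteq> 0"
  shows "x ^ (CARD('a) - 1) = 1"
proof -
  have "bij_betw ((*) x) (- {0}) (- {0})"
    by (rule bij_betw_byWitness[where f' = "\<lambda>y. y / x"]) (use assms in auto)
  then have "(\<Prod>y\<in>- {0}. x * y) = (\<Prod>y\<in>- {0}. y)"
    by (rule prod.reindex_bij_betw)
  then have "x ^ card (- {0::'a}) * \<Prod>(- {0}) = \<Prod>(- {0})"
    by (simp add: prod.distrib)
  moreover have "\<Prod>(- {0::'a}) \<noteq> 0"
    by simp
  ultimately show ?thesis
    by (simp add: Compl_eq_Diff_UNIV card_Diff_singleton)
qed

lemma finite_field_power_card:
  fixes x :: "'a::{field,finite}"
  shows "x ^ CARD('a) = x"
  using finite_field_power_card_minus_one[of x]
  by (cases "x = 0") (auto simp: power_eq_if)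

text \<open>The polynomial \<open>monom 1 k - 1\<close> has at most \<open>k\<close> roots, fewer
  than there are nonzero elements.\<close>

lemma exists_power_neq_one:
  assumes "0 < k" "k < CARD('a) - 1"
  obtains x :: "'a::{field,finite}" where "x \<noteq> 0" "x ^ k \<noteq> 1"
proof -
  let ?p = "monom 1 k - 1 :: 'a poly"
  have deg: "degree ?p \<le> k"
    by (intro degree_diff_le degree_monom_le) simp
  have "coeff ?p k = 1"
    using assms by simp
  then have "?p \<noteq> 0"
    by (metis coeff_0 zero_neq_one)
  from card_poly_roots_bound[OF this] deg
  have "card {x::'a. x ^ k = 1} \<le> k"
    by (simp add: poly_monom)
  also have "k < card (- {0::'a})"
    using assms by (simp add: Compl_eq_Diff_UNIV card_Diff_singleton)
  finally have "\<not> - {0} \<subseteq> {x::'a. x ^ k = 1}"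
    by (meson card_mono finite leD)
  then show ?thesis
    using that by auto
qed

text \<open>Rewrite rules that cancel equal summands in characteristic 2; with
  \<open>algebra_simps\<close> they let the simplifier check polynomial identities.\<close>

lemma char2_simps:
  fixes u v :: "'a::field"
  assumes two: "(2::'a) = 0"
  shows "- u = u" "u + u = 0" "u + (u + v) = v"
proof -
  show double: "u + u = 0" for u :: 'a
    using two by (metis mult_2 mult_zero_left)
  then show "- u = u"
    by (metis minus_unique)
  show "u + (u + v) = v"
    using double[of u] by (simp flip: add.assoc)
qed

text \<open>Reduction modulo the cubic of \<open>w\<close>. The rule with \<open>u\<close> reaches
  into right-nested products; the last one is the fifth power of \<open>w ^ 4\<close> in reduced
  form.\<close>

lemma F8_simps:
  fixes w :: "'a::field"
  assumes two: "(2::'a) = 0" and w: "w ^ 3 = w + 1"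
  shows "w * (w * w) = w + 1" "w * (w * (w * u)) = w * u + u"
    and "w ^ 4 = w + w * w" "w ^ 5 = w * w + w + 1"
    and "(w\<^sup>2) ^ 5 = w + 1" "(w + w * w) ^ 5 = w * w + 1"
proof -
  show cube: "w * (w * w) = w + 1"
    using w by (simp add: eval_nat_numeral)
  show cube': "w * (w * (w * u)) = w * u + u" for u
  proof -
    have "w * (w * (w * u)) = (w * (w * w)) * u"
      by (simp only: mult.assoc)
    then show ?thesis
      by (simp add: cube algebra_simps)
  qed
  show "w ^ 4 = w + w * w" "w ^ 5 = w * w + w + 1"
    and "(w\<^sup>2) ^ 5 = w + 1" "(w + w * w) ^ 5 = w * w + 1"
    by (simp_all add: eval_nat_numeral algebra_simps cube cube' char2_simps[OF two])
qed

lemma exists_generator_F8: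
  assumes "CARD('a) = 8 ^ m" "m > 0" and two: "(2::'a) = 0"
  obtains w :: "'a::{field,finite}" where "w ^ 3 = w + 1"
proof -
  have "[(8::nat) ^ m = 1 ^ m] (mod 7)"
    by (intro cong_pow) (simp add: cong_def)
  then have "(7::nat) dvd 8 ^ m - 1"
    by (simp add: cong_altdef_nat)
  then obtain k where k: "(8::nat) ^ m - 1 = 7 * k"
    by auto
  moreover have "(8::nat) ^ m > 1"
    using assms(2) by (metis one_less_numeral_iff one_less_power semiring_norm(76))
  ultimately have "0 < k" "k < CARD('a) - 1"
    using assms(1) by auto
  then obtain x :: 'a where x: "x \<noteq> 0" "x ^ k \<noteq> 1"
    by (rule exists_power_neq_one)
  define w where "w = x ^ k"
  have "w ^ 7 = x ^ (CARD('a) - 1)"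
    using k assms(1) by (simp add: w_def mult.commute flip: power_mult)
  then have w7: "w ^ 7 = 1"
    using finite_field_power_card_minus_one[OF x(1)] by simp
  \<comment> \<open>The factorization of the seventh cyclotomic polynomial over the field with 2
    elements into two cubics.\<close>
  have "(w - 1) * ((w ^ 3 - (w + 1)) * (w ^ 3 - (w\<^sup>2 + 1))) = w ^ 7 - 1"
    by (simp add: eval_nat_numeral algebra_simps char2_simps[OF two])
  then have "w ^ 3 = w + 1 \<or> w ^ 3 = w\<^sup>2 + 1"
    using x(2) w7 by (auto simp: w_def)
  then show ?thesis
  proof
    assume w: "w ^ 3 = w\<^sup>2 + 1"
    \<comment> \<open>Adding 1 turns a root of the second cubic into a root of the first.\<close>
    have "(w + 1) ^ 3 = w ^ 3 + w\<^sup>2 + w + 1"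
      by (simp add: eval_nat_numeral algebra_simps char2_simps[OF two])
    also have "\<dots> = (w + 1) + 1"
      unfolding w by (simp add: eval_nat_numeral algebra_simps char2_simps[OF two])
    finally show ?thesis
      by (rule that)
  qed (rule that)
qed

text \<open>By Cramer's rule the determinant of the system annihilates \<open>x\<close>; reduction
  modulo the cubic of \<open>w\<close> then confirms its factorization.\<close>

lemma determinant_factorization:
  fixes a b c x y z w :: "'a::field"
  assumes two: "(2::'a) = 0" and w: "w ^ 3 = w + 1"
    and eqs: "(a + b) * x + (a + c) * y + b * z = 0"
      "(b + c) * y + (b + a) * z + c * x = 0"
      "(c + a) * z + (c + b) * x + a * y = 0"
  shows "(a + w * b + w ^ 5 * c) * (a + w\<^sup>2 * b + (w\<^sup>2) ^ 5 * c) * (a + w ^ 4 * b + (w ^ 4) ^ 5 * c) * x = 0"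
proof -
  have "((a + b) * ((b + c) * (a + c) - a * (a + b)) - (a + c) * (c * (a + c) - (a + b) * (b + c))
      + b * (c * a - (b + c) * (b + c))) * x = 0"
    using eqs by algebra
  moreover have "(a + b) * ((b + c) * (a + c) - a * (a + b)) - (a + c) * (c * (a + c) - (a + b) * (b + c))
      + b * (c * a - (b + c) * (b + c))
      = (a + w * b + w ^ 5 * c) * (a + w\<^sup>2 * b + (w\<^sup>2) ^ 5 * c) * (a + w ^ 4 * b + (w ^ 4) ^ 5 * c)"
    by (simp add: F8_simps[OF two w] power2_eq_square algebra_simps char2_simps[OF two])
  ultimately show ?thesis
    by simp
qed

text \<open>The case where \<sigma> fixes \<open>r\<close>: the matrix is circulant and its
  determinant is the inverse of \<open>r\<close>.\<close>

lemma system_regular_fixed: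
  fixes a b c r :: "'a::field"
  assumes two: "(2::'a) = 0" and r: "r ^ 3 = r + 1"
    and eqs: "a + r * b + r ^ 5 * c = 0" "b + r * c + r ^ 5 * a = 0" "c + r * a + r ^ 5 * b = 0"
  shows "a = 0"
proof -
  define s where "s = r ^ 5"
  have "((1 - r * s) - r * (s - r * r) + s * (s * s - r)) * a = 0"
    using eqs unfolding s_def[symmetric] by algebra
  moreover have "r * ((1 - r * s) - r * (s - r * r) + s * (s * s - r)) = 1"
    by (simp add: s_def F8_simps[OF two r] algebra_simps char2_simps[OF two])
  ultimately show ?thesis
    by auto
qed

text \<open>The case where \<sigma> squares \<open>r\<close>: the rows carry the conjugates
  \<open>r\<close>, \<open>r\<^sup>2\<close>, \<open>r ^ 4\<close>, and the determinant is
  1.\<close>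

lemma system_regular_square:
  fixes a b c r :: "'a::field"
  assumes two: "(2::'a) = 0" and r: "r ^ 3 = r + 1"
    and eqs: "a + r * b + r ^ 5 * c = 0" "b + r\<^sup>2 * c + (r\<^sup>2) ^ 5 * a = 0"
      "c + r ^ 4 * a + (r ^ 4) ^ 5 * b = 0"
  shows "a = 0"
proof -
  define s t u v where "s = r ^ 5" and "t = (r\<^sup>2) ^ 5" and "u = r ^ 4" and "v = u ^ 5"
  have "((1 - r\<^sup>2 * v) - r * (t - r\<^sup>2 * u) + s * (t * v - u)) * a = 0"
    using eqs unfolding s_def[symmetric] t_def[symmetric] u_def[symmetric] v_def[symmetric]
    by algebra
  moreover have "(1 - r\<^sup>2 * v) - r * (t - r\<^sup>2 * u) + s * (t * v - u) = 1"
    by (simp add: s_def t_def u_def v_def F8_simps[OF two r] power2_eq_square algebra_simps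
        char2_simps[OF two])
  ultimately show ?thesis
    by simp
qed

lemma char2_power_add:
  fixes x y :: "'a::field"
  assumes two: "(2::'a) = 0"
  shows "(x + y) ^ 2 ^ n = x ^ 2 ^ n + y ^ 2 ^ n"
proof (induction n)
  case (Suc n)
  have "(x + y) ^ 2 ^ Suc n = (x ^ 2 ^ n + y ^ 2 ^ n)\<^sup>2"
    by (simp add: mult.commute[of 2] power_mult Suc.IH)
  also have "\<dots> = (x ^ 2 ^ n)\<^sup>2 + (y ^ 2 ^ n)\<^sup>2"
    by (simp add: power2_sum two)
  finally show ?case
    by (simp add: mult.commute flip: power_mult)
qed simp

text \<open>As \<open>r ^ 8 = r\<close>, only \<open>m mod 3\<close> matters. The excluded residue 2
  would give \<open>r ^ 4\<close>.\<close>

lemma F8_frobenius: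
  fixes r :: "'a::field"
  assumes two: "(2::'a) = 0" and r: "r ^ 3 = r + 1" and "\<not> [m = 2] (mod 3)"
  shows "r ^ 2 ^ m = r \<or> r ^ 2 ^ m = r\<^sup>2"
proof -
  have r8: "r ^ 8 = r"
    by (simp add: F8_simps[OF two r] eval_nat_numeral algebra_simps char2_simps[OF two])
  have r8n: "r ^ 8 ^ n = r" for n
    by (induction n) (simp_all add: r8 power_mult)
  have "m mod 3 = 0 \<or> m mod 3 = 1"
    using assms(3) unfolding cong_def by presburger
  then have "(2::nat) ^ m = 8 ^ (m div 3) \<or> (2::nat) ^ m = 8 ^ (m div 3) * 2"
  proof -
    have "(2::nat) ^ m = 2 ^ (3 * (m div 3) + m mod 3)"
      by simp
    also have "\<dots> = 8 ^ (m div 3) * 2 ^ (m mod 3)"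
      by (simp only: power_add power_mult) simp
    finally show ?thesis
      using \<open>m mod 3 = 0 \<or> m mod 3 = 1\<close> by auto
  qed
  then show ?thesis
    by (auto simp: r8n power_mult)
qed

theorem proposition3p6:
  fixes m :: nat
    and f :: "'a::{field,finite} \<Rightarrow> 'a"
  assumes "m > 0"
    and "\<not> [m = 2] (mod 3)"
    and "CARD('a) = 2 ^ (3 * m)"
    and "\<And>x. f x = x ^ (2 ^ m + 1) + x ^ (2 ^ (2 * m) + 2 ^ m)"
  shows "pseudo_planar f"
proof -
  \<comment> \<open>The field has even order, while raising to that order is the identity; hence -1
    = 1.\<close>
  have "(- 1 :: 'a) ^ CARD('a) = 1"
    using assms(1,3) by simp
  then have two: "(2::'a) = 0"
    using finite_field_power_card[of "- 1 :: 'a"] by (simp add: eq_neg_iff_add_eq_0)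
  have "CARD('a) = 8 ^ m"
    using assms(3) by (simp add: power_mult)
  then obtain w :: 'a where w: "w ^ 3 = w + 1"
    using exists_generator_F8[OF _ assms(1) two] by metis
  define s where "s x = x ^ 2 ^ m" for x :: 'a
  have s_add: "s (x + y) = s x + s y" and s_mult: "s (x * y) = s x * s y"
    and s_power: "s (x ^ n) = s x ^ n" and s_zero: "s 0 = 0" for x y n
    by (simp_all add: s_def char2_power_add[OF two] power_mult_distrib mult.commute flip: power_mult)
  have s_twice: "s (s x) = x ^ 2 ^ (2 * m)" for x
    by (simp add: s_def mult_2 power_add flip: power_mult)
  have "s (s (s x)) = x ^ CARD('a)" for x
    unfolding s_twice by (simp add: s_def assms(3) flip: power_mult power_add)
  then have s_thrice: "s (s (s x)) = x" for x
    by (simp add: finite_field_power_card)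
  have f: "f x = x * s x + s x * s (s x)" for x
    by (simp add: assms(4) s_twice power_add) (simp add: s_def)
  have factor_nonzero: "e + r * s e + r ^ 5 * s (s e) \<noteq> 0"
    if r: "r ^ 3 = r + 1" and e: "e \<noteq> 0" for e r
  proof
    assume eq0: "e + r * s e + r ^ 5 * s (s e) = 0"
    have eq1: "s e + s r * s (s e) + s r ^ 5 * e = 0"
      using arg_cong[OF eq0, of s] by (simp add: s_add s_mult s_power s_zero s_thrice)
    have eq2: "s (s e) + s (s r) * e + s (s r) ^ 5 * s e = 0"
      using arg_cong[OF eq1, of s] by (simp add: s_add s_mult s_power s_zero s_thrice)
    consider "s r = r" | "s r = r\<^sup>2"
      using F8_frobenius[OF two r assms(2)] by (auto simp: s_def)
    then show False
    proof cases
      case 1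
      then show False
        using system_regular_fixed[OF two r eq0] eq1 eq2 e by simp
    next
      case 2
      then have "s (s r) = r ^ 4"
        by (simp add: s_power flip: power_mult)
      then show False
        using system_regular_square[OF two r eq0] eq1 eq2 e 2 by simp
    qed
  qed
  \<comment> \<open>The conjugates of \<open>w\<close> satisfy the same cubic, so
    \<open>factor_nonzero\<close> covers all three linear factors.\<close>
  have w2: "(w\<^sup>2) ^ 3 = w\<^sup>2 + 1" and w4: "(w ^ 4) ^ 3 = w ^ 4 + 1"
    by (simp_all add: eval_nat_numeral algebra_simps F8_simps(1,2)[OF two w] char2_simps[OF two])
  have "bij (\<lambda>x. f (x + e) + f x + e * x)" if e: "e \<noteq> 0" for e
  proof -
    define a b c where "a = e" and "b = s e" and "c = s (s e)"
    define L where "L x = (a + b) * x + (a + c) * s x + b * s (s x)" for x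
    have sabc: "s a = b" "s b = c" "s c = a"
      by (simp_all add: a_def b_def c_def s_thrice)
    \<comment> \<open>Both terms of \<open>f\<close> are bilinear in \<open>x\<close> and its images
      under \<open>s\<close>, so only the cross terms and the constant \<open>f e\<close>
      survive.\<close>
    have diff: "f (x + e) + f x + e * x = L x + f e" for x
      by (simp add: f L_def s_add a_def b_def c_def algebra_simps char2_simps[OF two])
    have kernel: "x = 0" if "L x = 0" for x
    proof -
      have eq0: "(a + b) * x + (a + c) * s x + b * s (s x) = 0"
        using that by (simp add: L_def)
      have eq1: "(b + c) * s x + (b + a) * s (s x) + c * x = 0"
        using arg_cong[OF eq0, of s] by (simp add: s_add s_mult s_zero s_thrice sabc)
      have eq2: "(c + a) * s (s x) + (c + b) * x + a * s x = 0"
        using arg_cong[OF eq1, of s] by (simp add: s_add s_mult s_zero s_thrice sabc)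
      show "x = 0"
        using determinant_factorization[OF two w eq0 eq1 eq2]
          factor_nonzero[OF w e] factor_nonzero[OF w2 e] factor_nonzero[OF w4 e]
        unfolding a_def b_def c_def mult_eq_0_iff by blast
    qed
    have "inj (\<lambda>x. L x + f e)"
    proof (rule injI)
      fix x y
      assume "L x + f e = L y + f e"
      moreover have "L (x + y) = L x + L y"
        by (simp add: L_def s_add algebra_simps)
      ultimately have "L (x + y) = 0"
        by (simp add: char2_simps(2)[OF two])
      then have "x = - y"
        using kernel by (simp add: eq_neg_iff_add_eq_0)
      then show "x = y"
        by (simp only: char2_simps(1)[OF two])
    qed
    then have "bij (\<lambda>x. L x + f e)"
      by (intro bijI finite_UNIV_inj_surj) simp_all
    then show ?thesis
      by (simp only: diff)
  qed
  then show ?thesis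
    by (simp add: pseudo_planar_def)
qed

end
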